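(* Let $G=(V,E)$ be a finite, simple, undirected, unweighted, connected graph with $n$ vertices. Let $u\neq v$ be vertices of $G$ such that $\{u,v\}$ is not an edge of $G$, and let $G\cup\{u,v\}$ be the graph obtained from $G$ by adding the edge $\{u,v\}$. Then $$R_{\mathrm{tot}}(G)-R_{\mathrm{tot}}(G\cup\{u,v\})=n\cdot\frac{B_{u,v}^2}{1+R_{u,v}},$$ where $R_{u,v}$ and $B_{u,v}$ are the effective resistance and the biharmonic distance between $u$ and $v$ in $G$.
   Context: $L=D-A$ is the Laplacian of a graph, with $A$ its adjacency matrix and $D$ its diagonal degree matrix; $L^{+}$ is the Moore–Penrose pseudoinverse of $L$; $1_v\in\mathbb{R}^V$ is the indicator vector of the vertex $v$. The effective resistance between $u$ and $v$ is $R_{u,v}=(1_u-1_v)^TL^{+}(1_u-1_v)$. The biharmonic distance between $u$ and $v$ is $B_{u,v}=\sqrt{(1_u-1_v)^T(L^{+})^2(1_u-1_v)}$. The total effective resistance $R_{\mathrm{tot}}(G)$ of a connected graph $G$ is the sum of the effective resistances in $G$ over all unordered pairs of distinct vertices. *)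

theory Defs
  imports
    "HOL-Analysis.Analysis"
    "Graph_Theory.Pair_Digraph"
    "Graph_Theory.Digraph_Component"
begin

text \<open>
  Following \<^theory>\<open>Graph_Theory.Digraph\<close>, a simple undirected graph is a loop-free symmetric
  digraph without parallel arcs (locale \<^locale>\<open>pair_graph\<close>): an edge \<open>{u, v}\<close> is
  the pair of arcs \<open>(u, v)\<close>, \<open>(v, u)\<close>.  Vectors and matrices are indexed by a finite type
  \<open>'v\<close>, so the matrices below are the matrices of \<open>G\<close> only if \<open>pverts G = UNIV\<close>.
\<close>

definition add_edge :: "'v pair_pre_digraph \<Rightarrow> 'v \<Rightarrow> 'v \<Rightarrow> 'v pair_pre_digraph" where
  "add_edge G u v = G\<lparr>parcs := parcs G \<union> {(u, v), (v, u)}\<rparr>"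

definition adjacency_matrix :: "'v::finite pair_pre_digraph \<Rightarrow> real^'v^'v" where
  "adjacency_matrix G = (\<chi> i j. if (i, j) \<in> parcs G then 1 else 0)"

definition degree_matrix :: "'v::finite pair_pre_digraph \<Rightarrow> real^'v^'v" where
  "degree_matrix G = (\<chi> i j. if i = j then real (out_degree (with_proj G) i) else 0)"

definition laplacian :: "'v::finite pair_pre_digraph \<Rightarrow> real^'v^'v" where
  "laplacian G = degree_matrix G - adjacency_matrix G"

text \<open>The four Penrose equations.\<close>

definition is_pseudoinverse :: "real^'n^'m \<Rightarrow> real^'m^'n \<Rightarrow> bool" where
  "is_pseudoinverse M X \<longleftrightarrow>
     M ** X ** M = M \<and> X ** M ** X = X \<and>
     transpose (M ** X) = M ** X \<and> transpose (X ** M) = X ** M"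

lemma is_pseudoinverse_unique:
  assumes X: "is_pseudoinverse M X" and Y: "is_pseudoinverse M Y"
  shows "X = Y"
proof -
  have MX: "M ** X = M ** Y"
  proof -
    have "M ** X = transpose (M ** Y ** (M ** X))"
      using X Y by (simp add: is_pseudoinverse_def matrix_mul_assoc)
    also have "\<dots> = transpose (M ** X) ** transpose (M ** Y)"
      by (rule matrix_transpose_mul)
    also have "\<dots> = M ** Y"
      using X Y by (simp add: is_pseudoinverse_def matrix_mul_assoc)
    finally show ?thesis .
  qed
  have XM: "X ** M = Y ** M"
  proof -
    have "X ** M = transpose (X ** M ** (Y ** M))"
      using X Y unfolding is_pseudoinverse_def by (metis matrix_mul_assoc)
    also have "\<dots> = transpose (Y ** M) ** transpose (X ** M)"
      by (rule matrix_transpose_mul)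
    also have "\<dots> = Y ** M"
      using X Y unfolding is_pseudoinverse_def by (metis matrix_mul_assoc)
    finally show ?thesis .
  qed
  have "X = X ** (M ** X)"
    using X by (simp add: is_pseudoinverse_def matrix_mul_assoc)
  also have "\<dots> = (X ** M) ** Y"
    by (simp add: MX matrix_mul_assoc)
  also have "\<dots> = Y"
    using Y by (simp add: XM is_pseudoinverse_def)
  finally show ?thesis .
qed

definition pseudoinverse :: "real^'n^'m \<Rightarrow> real^'m^'n" where
  "pseudoinverse M = (THE X. is_pseudoinverse M X)"

lemma pseudoinverse_eqI: "is_pseudoinverse M X \<Longrightarrow> pseudoinverse M = X"
  unfolding pseudoinverse_def by (blast intro: is_pseudoinverse_unique the_equality)

text \<open>\<open>axis u 1\<close> is the indicator vector of \<open>u\<close>, and \<open>x \<bullet> (M *v x)\<close> is the quadratic form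
  of \<open>M\<close> at \<open>x\<close>.\<close>

definition effective_resistance :: "'v::finite pair_pre_digraph \<Rightarrow> 'v \<Rightarrow> 'v \<Rightarrow> real" where
  "effective_resistance G u v =
     (axis u 1 - axis v 1) \<bullet> (pseudoinverse (laplacian G) *v (axis u 1 - axis v 1))"

definition biharmonic_distance :: "'v::finite pair_pre_digraph \<Rightarrow> 'v \<Rightarrow> 'v \<Rightarrow> real" where
  "biharmonic_distance G u v =
     sqrt ((axis u 1 - axis v 1) \<bullet>
       ((pseudoinverse (laplacian G) ** pseudoinverse (laplacian G)) *v (axis u 1 - axis v 1)))"

lemma effective_resistance_commute:
  "effective_resistance G u v = effective_resistance G v u"
  unfolding effective_resistance_def
  by (simp add: matrix_vector_mult_diff_distrib inner_diff_left inner_diff_right)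

text \<open>The value at an unordered pair \<open>{s, t}\<close>; it does not depend on the order of \<open>s\<close> and \<open>t\<close>
  by the previous lemma.\<close>

definition pair_resistance :: "'v::finite pair_pre_digraph \<Rightarrow> 'v set \<Rightarrow> real" where
  "pair_resistance G p = (THE r. \<exists>s t. p = {s, t} \<and> r = effective_resistance G s t)"

lemma pair_resistance_doubleton: "pair_resistance G {s, t} = effective_resistance G s t"
  unfolding pair_resistance_def
  by (rule the_equality) (auto simp: doubleton_eq_iff effective_resistance_commute)

definition total_resistance :: "'v::finite pair_pre_digraph \<Rightarrow> real" where
  "total_resistance G = (\<Sum>p | p \<subseteq> pverts G \<and> card p = 2. pair_resistance G p)"

end

theory Submission
  imports Defs
begin

text \<open>
  With \<open>b = 1\<^sub>u - 1\<^sub>v\<close>, adding the edge turns \<open>L\<close> into \<open>L + b b\<^sup>T\<close>.  Since \<open>b\<close> is orthogonal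
  to the constant vectors, it lies in the range of \<open>L\<close>, so the Sherman--Morrison formula holds for the
  pseudoinverse: \<open>L\<^sup>+\<close> becomes \<open>L\<^sup>+ - y y\<^sup>T / (1 + R)\<close>, where \<open>y = L\<^sup>+ b\<close> and
  \<open>R = b\<^sup>T y\<close>.  Hence the resistance between \<open>s\<close> and \<open>t\<close> drops by
  \<open>(y\<^sub>s - y\<^sub>t)\<^sup>2 / (1 + R)\<close>.  As the entries of \<open>y\<close> add up to zero, summing over all pairs
  gives \<open>n (y \<bullet> y) / (1 + R)\<close>, and \<open>y \<bullet> y = b\<^sup>T (L\<^sup>+)\<^sup>2 b\<close>.
\<close>

section \<open>Symmetric matrices and their pseudoinverses\<close>

definition outer :: "real^'m \<Rightarrow> real^'n \<Rightarrow> real^'n^'m" where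
  "outer x y = (\<chi> i j. x $ i * y $ j)"

lemma outer_mult_vector: "outer x y *v z = (y \<bullet> z) *\<^sub>R x"
  by (simp add: outer_def matrix_vector_mult_def vec_eq_iff inner_vec_def
      sum_distrib_left sum_distrib_right mult_ac)

lemma transpose_outer: "transpose (outer x y) = outer y x"
  by (simp add: outer_def transpose_def vec_eq_iff mult.commute)

lemma transpose_add: "transpose (A + B :: real^'n^'m) = transpose A + transpose B"
  by (simp add: transpose_def vec_eq_iff)

lemma transpose_diff: "transpose (A - B :: real^'n^'m) = transpose A - transpose B"
  by (simp add: transpose_def vec_eq_iff)

lemma symmetric_matrix_inner:
  fixes A :: "real^'n^'n"
  assumes "transpose A = A"
  shows "x \<bullet> (A *v y) = (A *v x) \<bullet> y"
  using assms by (metis dot_lmul_matrix transpose_matrix_vector)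

lemma is_pseudoinverse_transpose:
  assumes "is_pseudoinverse M X"
  shows "is_pseudoinverse (transpose M) (transpose X)"
  using assms unfolding is_pseudoinverse_def
  by (metis matrix_mul_assoc matrix_transpose_mul)

text \<open>Transposing the Penrose equations shows that \<open>transpose X\<close> is again a
  pseudoinverse of \<open>M\<close>, so uniqueness applies; commutation then follows by transposing
  the symmetric matrix \<open>M ** X\<close>.\<close>

lemma symmetric_pseudoinverse:
  assumes "transpose M = M" "is_pseudoinverse M X"
  shows "transpose X = X" "X ** M = M ** X"
proof -
  show *: "transpose X = X"
    using assms is_pseudoinverse_transpose is_pseudoinverse_unique by metis
  show "X ** M = M ** X"
    using assms * unfolding is_pseudoinverse_def by (metis matrix_transpose_mul)
qed

text \<open>Transposing \<open>M ** X = C\<close> gives \<open>X ** M = C\<close>, so a single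
  projection \<open>C\<close> serves on both sides and it remains to see that it fixes
  \<open>M\<close> and \<open>X\<close>.\<close>

lemma symmetric_is_pseudoinverseI:
  assumes "transpose M = M" "transpose X = X" "M ** X = C" "transpose C = C"
    and "C ** M = M" "C ** X = X"
  shows "is_pseudoinverse M X"
proof -
  have "X ** M = C"
    using assms by (metis matrix_transpose_mul)
  then show ?thesis
    using assms by (simp add: is_pseudoinverse_def)
qed

text \<open>As \<open>b\<close> lies in the range of \<open>M\<close>, the update leaves the range
  unchanged; hence the new product is the old projection \<open>M ** X\<close>, and the criterion
  above applies with that \<open>C\<close>.\<close>

theorem is_pseudoinverse_rank_one_update:
  fixes M X :: "real^'n^'n" and b :: "real^'n"
  defines "y \<equiv> X *v b"
  assumes sym: "transpose M = M" and X: "is_pseudoinverse M X"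
    and range: "M *v y = b" and nz: "1 + b \<bullet> y \<noteq> 0"
  shows "is_pseudoinverse (M + outer b b) (X - (1 / (1 + b \<bullet> y)) *\<^sub>R outer y y)"
    (is "is_pseudoinverse ?M ?X")
proof (rule symmetric_is_pseudoinverseI[where C = "M ** X"])
  let ?c = "1 + b \<bullet> y"
  note symX = symmetric_pseudoinverse[OF sym X]
  have X_eq: "?X *v z = X *v z - ((y \<bullet> z) / ?c) *\<^sub>R y" for z
    by (simp add: matrix_vector_mult_diff_rdistrib outer_mult_vector flip: scaleR_matrix_vector_assoc)
  have M_eq: "?M *v z = M *v z + (b \<bullet> z) *\<^sub>R b" for z
    by (simp add: matrix_vector_mult_add_rdistrib outer_mult_vector)
  show "transpose ?M = ?M"
    by (simp add: transpose_add transpose_outer sym)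
  show "transpose ?X = ?X"
    by (simp add: transpose_diff transpose_scalar transpose_outer symX)
  show "transpose (M ** X) = M ** X"
    using X by (simp add: is_pseudoinverse_def)
  have "?M *v (?X *v z) = M *v (X *v z)" for z
  proof -
    have "b \<bullet> (X *v z) = y \<bullet> z"
      using symX(1) by (simp add: y_def symmetric_matrix_inner)
    then have "?M *v (?X *v z)
        = M *v (X *v z) + ((y \<bullet> z) - (y \<bullet> z) / ?c - (y \<bullet> z) / ?c * (b \<bullet> y)) *\<^sub>R b"
      by (simp only: X_eq M_eq matrix_vector_mult_diff_distrib matrix_vector_mult_scaleR range
          inner_diff_right inner_scaleR_right scaleR_left_diff_distrib scaleR_right_distrib scaleR_left_distrib scaleR_scaleR
          add_diff_eq diff_add_eq diff_diff_eq)
    \<comment> \<open>The coefficient is \<open>y \<bullet> z\<close> times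
      \<open>1 - 1/c - (c - 1)/c\<close>, with \<open>c = 1 + b \<bullet> y\<close>.\<close>
    also have "(y \<bullet> z) - (y \<bullet> z) / ?c - (y \<bullet> z) / ?c * (b \<bullet> y) = 0"
      using nz by (simp add: field_simps)
    finally show ?thesis
      by simp
  qed
  then show "?M ** ?X = M ** X"
    by (simp add: matrix_eq flip: matrix_vector_mul_assoc)
  have MXM: "M *v (X *v (M *v z)) = M *v z" for z
    using X by (metis is_pseudoinverse_def matrix_vector_mul_assoc)
  have MXX: "M *v (X *v (X *v z)) = X *v z" for z
    using X symX(2) by (metis is_pseudoinverse_def matrix_vector_mul_assoc)
  have "M *v (X *v (?M *v z)) = ?M *v z" for z
    using range by (simp add: M_eq matrix_vector_right_distrib matrix_vector_mult_scaleR MXM y_def)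
  then show "(M ** X) ** ?M = ?M"
    by (simp add: matrix_eq flip: matrix_vector_mul_assoc)
  \<comment> \<open>The correction term is a multiple of \<open>y = X *v b\<close>, which the
    projection fixes by \<open>MXX\<close>.\<close>
  have "M *v (X *v (?X *v z)) = ?X *v z" for z
    unfolding X_eq
    by (simp add: matrix_vector_mult_diff_distrib matrix_vector_mult_scaleR MXX MXX[of b, folded y_def])
  then show "(M ** X) ** ?X = ?X"
    by (simp add: matrix_eq flip: matrix_vector_mul_assoc)
qed

text \<open>\<open>M + P\<close> is invertible, and the pseudoinverse of \<open>M\<close> is \<open>(M + P)\<^sup>-\<^sup>1 - P\<close>.\<close>

lemma kernel_projection_pseudoinverse:
  fixes M P :: "real^'n^'n"
  assumes sym: "transpose M = M" "transpose P = P"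
    and PP: "P ** P = P" and PM: "P ** M = 0"
    and ker: "\<And>x. M *v x = 0 \<Longrightarrow> P *v x = x"
  obtains X where "is_pseudoinverse M X" "M ** X = mat 1 - P"
proof -
  have MP: "M ** P = 0"
    using sym PM by (metis matrix_transpose_mul transpose_mat mat_0)
  have PMx: "P *v (M *v x) = 0" and PPx: "P *v (P *v x) = P *v x" and MPx: "M *v (P *v x) = 0" for x
    by (simp_all add: matrix_vector_mul_assoc PM PP MP)
  \<comment> \<open>Applying \<open>P\<close> removes the \<open>M\<close> part and leaves
    \<open>P *v x = 0\<close>; then \<open>M *v x = 0\<close>, and \<open>ker\<close> gives
    \<open>x = P *v x = 0\<close>.\<close>
  have "x = 0" if x: "(M + P) *v x = 0" for x
  proof -
    have *: "M *v x + P *v x = 0"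
      using x by (simp add: matrix_vector_mult_add_rdistrib)
    then have "P *v (M *v x + P *v x) = 0"
      by simp
    then have "P *v x = 0"
      by (simp add: matrix_vector_right_distrib PMx PPx)
    with * ker show ?thesis
      by simp
  qed
  then obtain Y where Y: "Y ** (M + P) = mat 1"
    using matrix_left_invertible_ker by metis
  then have Y': "(M + P) ** Y = mat 1"
    by (simp add: matrix_left_right_inverse)
  have symY: "transpose Y = Y"
  proof -
    have "transpose Y ** (M + P) = mat 1"
      using arg_cong[OF Y', of transpose] sym by (simp add: matrix_transpose_mul transpose_add)
    then show ?thesis
      using Y' by (metis matrix_mul_assoc matrix_mul_lid matrix_mul_rid)
  qed
  have Yx: "Y *v (M *v x) + Y *v (P *v x) = x" for x
    using arg_cong[OF Y, of "\<lambda>A. A *v x"]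
    by (simp add: matrix_vector_mult_add_rdistrib matrix_vector_right_distrib flip: matrix_vector_mul_assoc)
  have Yx': "M *v (Y *v x) + P *v (Y *v x) = x" for x
    using arg_cong[OF Y', of "\<lambda>A. A *v x"]
    by (simp add: matrix_vector_mult_add_rdistrib flip: matrix_vector_mul_assoc)
  have PYx: "P *v (Y *v x) = P *v x" for x
    using arg_cong[OF Yx'[of x], of "\<lambda>z. P *v z"]
    by (simp add: matrix_vector_right_distrib PMx PPx)
  \<comment> \<open>Since \<open>M ** P = 0\<close>, this is \<open>M ** Y\<close>, and
    \<open>(M + P) ** Y = mat 1\<close> with \<open>P ** Y = P\<close> evaluates it.\<close>
  have MX: "M ** (Y - P) = mat 1 - P"
  proof -
    have "M *v (Y *v x) = x - P *v x" for x
      using Yx'[of x] by (simp add: PYx algebra_simps)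
    then show ?thesis
      by (simp add: matrix_eq matrix_vector_mult_diff_rdistrib matrix_vector_mult_diff_distrib MPx
          flip: matrix_vector_mul_assoc)
  qed
  have "is_pseudoinverse M (Y - P)"
  proof (rule symmetric_is_pseudoinverseI[OF sym(1) _ MX])
    show "transpose (Y - P) = Y - P" "transpose (mat 1 - P) = mat 1 - P"
      by (simp_all add: transpose_diff symY sym)
    show "(mat 1 - P) ** M = M" "(mat 1 - P) ** (Y - P) = Y - P"
      by (simp_all add: matrix_eq matrix_vector_mult_diff_rdistrib matrix_vector_mult_diff_distrib
          PMx PPx PYx flip: matrix_vector_mul_assoc)
  qed
  with MX show ?thesis
    using that by blast
qed

section \<open>The Laplacian\<close>

lemma real_out_degree:
  fixes G :: "'v::finite pair_pre_digraph"
  shows "real (out_degree (with_proj G) i) = (\<Sum>j\<in>UNIV. if (i, j) \<in> parcs G then 1 else 0)"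
proof -
  have "out_arcs (with_proj G) i = Pair i ` {j. (i, j) \<in> parcs G}"
    by (auto simp: out_arcs_def)
  then show ?thesis
    by (simp add: out_degree_def card_image inj_on_def sum.If_cases)
qed

text \<open>The degree term is spread over the neighbours of \<open>i\<close>. In this form
  constants are visibly annihilated and the effect of a new arc can be read off.\<close>

lemma laplacian_mult_component:
  "(laplacian G *v x) $ i = (\<Sum>j\<in>UNIV. if (i, j) \<in> parcs G then x $ i - x $ j else 0)"
proof -
  have "(degree_matrix G *v x) $ i = real (out_degree (with_proj G) i) * x $ i"
    by (simp add: degree_matrix_def matrix_vector_mult_def if_distrib[of "\<lambda>a. a * _"] cong: if_cong)
  moreover have "(adjacency_matrix G *v x) $ i = (\<Sum>j\<in>UNIV. if (i, j) \<in> parcs G then x $ j else 0)"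
    by (simp add: adjacency_matrix_def matrix_vector_mult_def if_distrib[of "\<lambda>a. a * _"] cong: if_cong)
  ultimately show ?thesis
    by (simp add: laplacian_def matrix_vector_mult_diff_rdistrib real_out_degree sum_distrib_right
        flip: sum_subtractf) (rule sum.cong, auto)
qed

lemma transpose_laplacian:
  assumes "sym (parcs G)"
  shows "transpose (laplacian G) = laplacian G"
  using assms
  by (auto simp: transpose_def laplacian_def degree_matrix_def adjacency_matrix_def vec_eq_iff dest: symD)

lemma laplacian_quadratic_form:
  assumes "sym (parcs G)"
  shows "x \<bullet> (laplacian G *v x)
    = (\<Sum>i\<in>UNIV. \<Sum>j\<in>UNIV. if (i, j) \<in> parcs G then (x $ i - x $ j)\<^sup>2 else 0) / 2"
proof -
  let ?f = "\<lambda>i j. if (i, j) \<in> parcs G then x $ i * (x $ i - x $ j) else 0"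
  have eq: "x \<bullet> (laplacian G *v x) = (\<Sum>i\<in>UNIV. \<Sum>j\<in>UNIV. ?f i j)"
    by (auto simp: inner_vec_def laplacian_mult_component sum_distrib_left intro!: sum.cong)
  \<comment> \<open>Symmetrisation: \<open>?f i j + ?f j i\<close> is the squared difference on
    every arc, because arcs come in opposite pairs.\<close>
  have "2 * (x \<bullet> (laplacian G *v x)) = (\<Sum>i\<in>UNIV. \<Sum>j\<in>UNIV. ?f i j) + (\<Sum>i\<in>UNIV. \<Sum>j\<in>UNIV. ?f j i)"
    by (simp add: eq) (rule sum.swap)
  also have "\<dots> = (\<Sum>i\<in>UNIV. \<Sum>j\<in>UNIV. if (i, j) \<in> parcs G then (x $ i - x $ j)\<^sup>2 else 0)"
    unfolding sum.distrib[symmetric] using assms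
    by (intro sum.cong refl) (auto dest: symD simp: power2_eq_square algebra_simps)
  finally show ?thesis
    by simp
qed

text \<open>The quadratic form vanishes at \<open>x\<close>, so each squared difference along an arc
  is zero; equality then propagates along paths.\<close>

lemma laplacian_kernel:
  assumes "sym (parcs G)" "pverts G = UNIV" "Digraph_Component.connected (with_proj G)"
    and "laplacian G *v x = 0"
  shows "x $ i = x $ j"
proof -
  have "(\<Sum>i\<in>UNIV. \<Sum>j\<in>UNIV. if (i, j) \<in> parcs G then (x $ i - x $ j)\<^sup>2 else 0) = 0"
    using laplacian_quadratic_form[OF assms(1), of x] assms(4) by simp
  then have arc: "x $ k = x $ l" if "(k, l) \<in> parcs G" for k l
    using that by (auto simp: sum_nonneg_eq_0_iff sum_nonneg split: if_splits)
  \<comment> \<open>Connectedness is reachability in the symmetric closure; arcs used backwards do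
    no harm, as equality of entries is symmetric.\<close>
  have "i \<rightarrow>\<^sup>*\<^bsub>with_proj (mk_symmetric (with_proj G))\<^esub> j"
    using assms(2,3) by (simp add: connected_def strongly_connected_def)
  then have "(i, j) \<in> (parcs (mk_symmetric (with_proj G)))\<^sup>*"
    using reachable_rtranclI by fastforce
  then show ?thesis
    by (induction rule: rtrancl_induct) (auto simp: parcs_mk_symmetric dest: arc)
qed

text \<open>The new arcs add \<open>x $ u - x $ v\<close> to row \<open>u\<close> and its negative
  to row \<open>v\<close>, which together form \<open>(b \<bullet> x) *\<^sub>R b\<close> for
  \<open>b = axis u 1 - axis v 1\<close>.\<close>

lemma laplacian_add_edge:
  assumes "u \<noteq> v" "(u, v) \<notin> parcs G" "(v, u) \<notin> parcs G"
  shows "laplacian (add_edge G u v) = laplacian G + outer (axis u 1 - axis v 1) (axis u 1 - axis v 1)"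
proof -
  let ?b = "axis u 1 - axis v 1 :: real^'a"
  have "(laplacian (add_edge G u v) *v x) $ i = (laplacian G *v x) $ i + (?b \<bullet> x) * ?b $ i" for x i
  proof -
    have "(laplacian (add_edge G u v) *v x) $ i
      = (\<Sum>j\<in>UNIV. (if (i, j) \<in> parcs G then x $ i - x $ j else 0)
          + (if j = v then if i = u then x $ u - x $ v else 0 else 0)
          + (if j = u then if i = v then x $ v - x $ u else 0 else 0))"
      unfolding laplacian_mult_component using assms
      by (intro sum.cong) (auto simp: add_edge_def)
    also have "\<dots> = (laplacian G *v x) $ i
        + (if i = u then x $ u - x $ v else 0) + (if i = v then x $ v - x $ u else 0)"
      by (simp add: sum.distrib laplacian_mult_component)
    finally show ?thesis
      using assms(1) by (simp add: inner_diff_left inner_axis') (simp add: axis_def)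
  qed
  then show ?thesis
    by (simp add: matrix_eq matrix_vector_mult_add_rdistrib outer_mult_vector vec_eq_iff)
qed

text \<open>The constant matrix averages the entries of a vector: it is the orthogonal projection
  onto the constants, which form the kernel of a connected Laplacian.\<close>

lemma connected_laplacian_pseudoinverse:
  fixes G :: "'v::finite pair_pre_digraph"
  assumes "sym (parcs G)" "pverts G = UNIV" "Digraph_Component.connected (with_proj G)"
  obtains X where "is_pseudoinverse (laplacian G) X"
    and "laplacian G ** X = mat 1 - (\<chi> i j. 1 / real CARD('v))"
proof (rule kernel_projection_pseudoinverse)
  let ?L = "laplacian G" and ?P = "\<chi> i j. 1 / real CARD('v) :: real^'v^'v"
  show sym: "transpose ?L = ?L"
    using assms(1) by (rule transpose_laplacian)
  show symP: "transpose ?P = ?P"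
    by (simp add: transpose_def)
  show "?P ** ?P = ?P"
    by (simp add: matrix_matrix_mult_def vec_eq_iff)
  have P_mult: "(?P *v x) $ i = (\<Sum>j\<in>UNIV. x $ j) / real CARD('v)" for x i
    by (simp add: matrix_vector_mult_def sum_divide_distrib)
  have "?L *v (?P *v x) = 0" for x
    unfolding vec_eq_iff laplacian_mult_component P_mult by (simp cong: if_cong)
  then have "?L ** ?P = 0"
    by (simp add: matrix_eq flip: matrix_vector_mul_assoc)
  then show "?P ** ?L = 0"
    using sym symP by (metis matrix_transpose_mul transpose_mat mat_0)
  show "?P *v x = x" if "?L *v x = 0" for x
  proof -
    have "(\<Sum>j\<in>UNIV. x $ j) = (\<Sum>j\<in>(UNIV :: 'v set). x $ i)" for i
      by (intro sum.cong refl laplacian_kernel[OF assms that])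
    then have "(?P *v x) $ i = x $ i" for i
      unfolding P_mult by (metis nonzero_mult_div_cancel_left of_nat_0_eq_iff sum_constant zero_less_card_finite less_irrefl)
    then show ?thesis
      by (simp add: vec_eq_iff)
  qed
qed (rule that)

section \<open>Sums over unordered pairs\<close>

lemma sum_unordered_pairs:
  fixes f :: "'a::finite set \<Rightarrow> real"
  shows "2 * (\<Sum>p | card p = 2. f p) = (\<Sum>s\<in>UNIV. \<Sum>t\<in>UNIV. if s = t then 0 else f {s, t})"
proof -
  let ?S = "{(s, t). s \<noteq> t}" and ?g = "\<lambda>(s, t). {s, t}"
  have "(\<Sum>s\<in>UNIV. \<Sum>t\<in>UNIV. if s = t then 0 else f {s, t}) = (\<Sum>q\<in>?S. f (?g q))"
    unfolding sum.cartesian_product by (rule sum.mono_neutral_cong_right) auto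
  \<comment> \<open>Ordered pairs are grouped by their underlying set; each fibre is
    \<open>{(s, t), (t, s)}\<close>.\<close>
  also have "\<dots> = (\<Sum>p | card p = 2. \<Sum>q\<in>{q \<in> ?S. ?g q = p}. f (?g q))"
    by (rule sum.group[symmetric]) auto
  also have "\<dots> = (\<Sum>p | card p = 2. 2 * f p)"
  proof (rule sum.cong)
    fix p :: "'a set" assume "p \<in> {p. card p = 2}"
    then obtain s t where p: "p = {s, t}" "s \<noteq> t"
      by (auto simp: card_2_iff)
    then have "{q \<in> ?S. ?g q = p} = {(s, t), (t, s)}"
      by (auto simp: doubleton_eq_iff)
    then show "(\<Sum>q\<in>{q \<in> ?S. ?g q = p}. f (?g q)) = 2 * f p"
      using p by (simp add: insert_commute)
  qed simp
  finally show ?thesis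
    by (simp add: sum_distrib_left)
qed

text \<open>Diagonal resistances are zero, so the ordered sum may run over all \<open>s\<close> and
  \<open>t\<close>.\<close>

lemma total_resistance_eq:
  assumes "pverts G = UNIV"
  shows "2 * total_resistance G = (\<Sum>s\<in>UNIV. \<Sum>t\<in>UNIV. effective_resistance G s t)"
proof -
  have "effective_resistance G s s = 0" for s
    by (simp add: effective_resistance_def)
  then show ?thesis
    unfolding total_resistance_def using assms
    by (simp add: sum_unordered_pairs) (intro sum.cong refl, auto simp: pair_resistance_doubleton)
qed

lemma sum_squared_differences:
  fixes y :: "real^'n"
  shows "(\<Sum>s\<in>UNIV. \<Sum>t\<in>UNIV. (y $ s - y $ t)\<^sup>2)
    = 2 * (real CARD('n) * (y \<bullet> y) - (\<Sum>s\<in>UNIV. y $ s)\<^sup>2)"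
proof -
  have "(y $ s - y $ t)\<^sup>2 = y $ s * y $ s + y $ t * y $ t - 2 * (y $ s * y $ t)" for s t
    by (simp add: power2_eq_square algebra_simps)
  then show ?thesis
    by (simp add: sum.distrib sum_subtractf inner_vec_def power2_eq_square
        flip: sum_distrib_left sum_distrib_right)
qed

theorem theorem4p1:
  fixes G :: "'v::finite pair_pre_digraph" and u v :: 'v
  assumes "pair_graph G"
    and "pverts G = UNIV"
    and "Digraph_Component.connected (with_proj G)"
    and "u \<noteq> v"
    and "(u, v) \<notin> parcs G"
  shows "total_resistance G - total_resistance (add_edge G u v) =
    real (card (pverts G)) * ((biharmonic_distance G u v)\<^sup>2 / (1 + effective_resistance G u v))"
proof -
  interpret pair_graph G
    by fact
  have sym: "sym (parcs G)"
    using pair_sym_arcs by (simp add: symmetric_def)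
  let ?L = "laplacian G"
  let ?L' = "laplacian (add_edge G u v)"
  define b :: "real^'v" where "b = axis u 1 - axis v 1"
  note symL = transpose_laplacian[OF sym]
  obtain X where X: "is_pseudoinverse ?L X"
    and LX: "?L ** X = mat 1 - (\<chi> i j. 1 / real CARD('v))"
    using connected_laplacian_pseudoinverse[OF sym assms(2,3)] by blast
  note symX = symmetric_pseudoinverse[OF symL X]
  have LX_mult: "(?L *v (X *v x)) $ i = x $ i - (\<Sum>j\<in>UNIV. x $ j) / real CARD('v)" for x i
    by (simp add: matrix_vector_mul_assoc LX matrix_vector_mult_diff_rdistrib)
      (simp add: matrix_vector_mult_def sum_divide_distrib)
  define y where "y = X *v b"
  define R where "R = b \<bullet> y"
  \<comment> \<open>With zero mean, \<open>b\<close> loses nothing under the projection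
    \<open>?L ** X\<close>, which places it in the range of \<open>?L\<close>.\<close>
  have "(\<Sum>j\<in>UNIV. b $ j) = 0"
    by (simp add: b_def sum_subtractf axis_def)
  then have Ly: "?L *v y = b"
    by (simp add: vec_eq_iff y_def LX_mult)
  \<comment> \<open>\<open>y\<close> lies in the range of \<open>X\<close>, so the projection fixes
    it; comparing with \<open>LX_mult\<close> at any one coordinate, here \<open>u\<close>, forces
    its mean to be zero.\<close>
  have "?L *v (X *v y) = y"
    using X symX(2) by (metis is_pseudoinverse_def matrix_vector_mul_assoc y_def)
  then have sum_y: "(\<Sum>j\<in>UNIV. y $ j) = 0"
    using LX_mult[of y u] by simp
  \<comment> \<open>Since \<open>?L *v y = b\<close>, this quadratic form equals \<open>R\<close>,
    so the denominator \<open>1 + R\<close> is positive.\<close>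
  have "0 \<le> y \<bullet> (?L *v y)"
    by (simp add: laplacian_quadratic_form[OF sym] sum_nonneg)
  then have "R \<ge> 0"
    by (simp add: R_def Ly inner_commute)
  then have nz: "1 + R \<noteq> 0"
    by simp
  have "(v, u) \<notin> parcs G"
    using assms(5) sym by (blast dest: symD)
  then have L': "?L' = ?L + outer b b"
    using assms(4,5) by (simp add: laplacian_add_edge b_def)
  have pinv: "pseudoinverse ?L = X"
    using X by (rule pseudoinverse_eqI)
  have pinv': "pseudoinverse ?L' = X - (1 / (1 + R)) *\<^sub>R outer y y"
    unfolding L' R_def y_def using X symL Ly nz
    by (intro pseudoinverse_eqI is_pseudoinverse_rank_one_update) (simp_all add: y_def R_def)
  have X': "(X - (1 / (1 + R)) *\<^sub>R outer y y) *v a = X *v a - ((y \<bullet> a) / (1 + R)) *\<^sub>R y" for a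
    by (simp add: matrix_vector_mult_diff_rdistrib outer_mult_vector flip: scaleR_matrix_vector_assoc)
  have form: "a \<bullet> (X *v a) - a \<bullet> ((X - (1 / (1 + R)) *\<^sub>R outer y y) *v a) = (y \<bullet> a)\<^sup>2 / (1 + R)" for a
    unfolding X' inner_diff_right by (simp add: inner_commute power2_eq_square)
  have diff: "effective_resistance G s t - effective_resistance (add_edge G u v) s t
      = (y $ s - y $ t)\<^sup>2 / (1 + R)" for s t
    unfolding effective_resistance_def pinv pinv' form by (simp add: inner_diff_right inner_axis)
  \<comment> \<open>Symmetry moves one factor \<open>X\<close> to the left argument; nonnegativity
    of \<open>y \<bullet> y\<close> lets the square undo the root.\<close>
  have B: "(biharmonic_distance G u v)\<^sup>2 = y \<bullet> y"
  proof -
    have "b \<bullet> ((X ** X) *v b) = y \<bullet> y"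
      by (simp add: y_def symmetric_matrix_inner[OF symX(1)] flip: matrix_vector_mul_assoc)
    then show ?thesis
      by (simp add: biharmonic_distance_def pinv flip: b_def)
  qed
  have R: "effective_resistance G u v = R"
    by (simp add: effective_resistance_def pinv R_def y_def b_def)
  have "pverts (add_edge G u v) = UNIV"
    using assms(2) by (simp add: add_edge_def)
  then have "2 * (total_resistance G - total_resistance (add_edge G u v))
      = (\<Sum>s\<in>UNIV. \<Sum>t\<in>UNIV. (y $ s - y $ t)\<^sup>2 / (1 + R))"
    using assms(2) by (simp add: right_diff_distrib total_resistance_eq diff flip: sum_subtractf)
  also have "\<dots> = 2 * (real CARD('v) * (y \<bullet> y)) / (1 + R)"
    by (simp add: sum_squared_differences sum_y flip: sum_divide_distrib)
  finally show ?thesis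
    by (simp add: R B assms(2))
qed

end
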